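(* Let $c\in(0,\frac12)$ and $m=cn$, and let $M$ be the adjacency matrix of the dense Barabási–Albert multigraph on $n$ vertices (defined in the context). For indices $k>j$ with $k/n\to y\in(0,1]$ and $j/n\to x\in(0,1]$, set $t_0=m+1$ and $s_0=\max\{j,t_0\}$. Then $$\mathbb{E}[M_{kj}]=m\,\frac{\mu_j(k-1)}{D_{k-1}}\ \to\ \frac{c}{\sqrt{(2\max\{x,c\}-c)(2y-c)}},\qquad n\to\infty,$$ where $D_t=2mt-m(m+1)$ and $\mu_j(\cdot)=\mathbb{E}[d_j(\cdot)]$. Moreover, $\mathbb{E}[M_{kj}]=O(1)$ uniformly in $j,k,n$.
   Context: Model. Fix rational $c\in(0,\frac12)$ and consider only integers $n$ such that $m:=cn$ is an integer; all limits are taken as $n\to\infty$ along this sequence. Let $t_0:=m+1$. At time $t_0$ the graph is the simple complete graph on vertices $1,\dots,m+1$. For each $t=t_0+1,\dots,n$ a new vertex $t$ is added together with $m$ edges; conditionally on the graph at time $t-1$, the $m$ edges are placed independently, each joining $t$ to vertex $j<t$ with probability $d_j(t-1)/D_{t-1}$, where $d_j(s)$ is the degree of vertex $j$ at time $s$ (counted with edge multiplicity) and $D_s$ is the total degree at time $s$, which equals $2ms-m(m+1)$ for all $s\ge t_0$. Multiple edges between the same pair of vertices are allowed. $M$ is the symmetric $n\times n$ matrix whose $(k,j)$ entry is the number of edges between $k$ and $j$ in the final graph (with $M_{kk}=0$).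
   Formalization: The limit is stated for y in [c,1] rather than (0,1], since for y<c the entry is constantly 1 and the displayed formula is false or undefined; the identity for the mean is stated for k>t_0, where the degrees at time k-1 exist. *)

theory Defs
  imports "HOL-Probability.Probability"
begin

text \<open>
  A multigraph at time \<open>s\<close> is given by its adjacency function \<open>G\<close>: vertices are
  \<open>1, \<dots>, s\<close>, \<open>G k j\<close> is the number of edges between \<open>k\<close> and \<open>j\<close>, and all entries
  outside \<open>{1..s}\<close> are \<open>0\<close>.
\<close>
type_synonym multigraph = "nat \<Rightarrow> nat \<Rightarrow> nat"

definition complete_graph :: "nat \<Rightarrow> multigraph" where
  "complete_graph s = (\<lambda>k j. if k \<in> {1..s} \<and> j \<in> {1..s} \<and> k \<noteq> j then 1 else 0)"

definition vertex_degree :: "multigraph \<Rightarrow> nat \<Rightarrow> nat \<Rightarrow> nat" where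
  "vertex_degree G s j = (\<Sum>i\<in>{1..s}. G j i)"

definition total_degree :: "multigraph \<Rightarrow> nat \<Rightarrow> nat" where
  "total_degree G s = (\<Sum>j\<in>{1..s}. vertex_degree G s j)"

definition target_pmf :: "multigraph \<Rightarrow> nat \<Rightarrow> nat pmf" where
  "target_pmf G s = embed_pmf (\<lambda>j.
     if j \<in> {1..s} then real (vertex_degree G s j) / real (total_degree G s) else 0)"

text \<open>\<^const>\<open>embed_pmf\<close> is specified only for weights that sum to \<open>1\<close>; they do
  as soon as the graph has an edge.\<close>
lemma pmf_target_pmf:
  assumes "total_degree G s > 0"
  shows "pmf (target_pmf G s) j =
    (if j \<in> {1..s} then real (vertex_degree G s j) / real (total_degree G s) else 0)"
proof -
  let ?f = "\<lambda>j. if j \<in> {1..s} then real (vertex_degree G s j) / real (total_degree G s) else 0"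
  have "(\<integral>\<^sup>+ j. ennreal (?f j) \<partial>count_space UNIV)
      = (\<integral>\<^sup>+ j. ennreal (?f j) \<partial>count_space {1..s})"
    by (rule nn_integral_count_space_eq) auto
  also have "\<dots> = (\<Sum>j\<in>{1..s}. ennreal (?f j))"
    by (simp add: nn_integral_count_space_finite)
  also have "\<dots> = ennreal (\<Sum>j\<in>{1..s}. ?f j)"
    by (rule sum_ennreal) auto
  also have "(\<Sum>j\<in>{1..s}. ?f j) = (\<Sum>j\<in>{1..s}. real (vertex_degree G s j)) / real (total_degree G s)"
    by (simp add: sum_divide_distrib)
  also have "\<dots> = 1"
    using assms unfolding total_degree_def of_nat_sum[symmetric]
    by (metis div_self of_nat_0_eq_iff less_irrefl)
  finally have "(\<integral>\<^sup>+ j. ennreal (?f j) \<partial>count_space UNIV) = 1" by simp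
  then show ?thesis
    unfolding target_pmf_def by (subst pmf_embed_pmf) auto
qed

text \<open>Adds vertex \<open>t\<close>; \<open>js\<close> lists the other endpoints of its new edges, with multiplicity.\<close>
definition attach :: "multigraph \<Rightarrow> nat \<Rightarrow> nat list \<Rightarrow> multigraph" where
  "attach G t js = (\<lambda>k j.
     G k j + (if k = t then count_list js j else 0) + (if j = t then count_list js k else 0))"

text \<open>
  Law of the graph at time \<open>t\<close>. For \<open>t \<le> m + 1\<close> it is, by convention, the deterministic
  complete graph on \<open>{1..m+1}\<close>; the model itself starts at time \<open>m + 1\<close>.
\<close>
primrec ba_graph :: "nat \<Rightarrow> nat \<Rightarrow> multigraph pmf" where
  "ba_graph m 0 = return_pmf (complete_graph (m + 1))"
| "ba_graph m (Suc t) =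
     (if Suc t \<le> m + 1 then return_pmf (complete_graph (m + 1))
      else bind_pmf (ba_graph m t) (\<lambda>G.
             map_pmf (attach G (Suc t)) (replicate_pmf m (target_pmf G t))))"

definition mean_entry :: "nat \<Rightarrow> nat \<Rightarrow> nat \<Rightarrow> nat \<Rightarrow> real" where
  "mean_entry m n k j = measure_pmf.expectation (ba_graph m n) (\<lambda>M. real (M k j))"

definition mean_degree :: "nat \<Rightarrow> nat \<Rightarrow> nat \<Rightarrow> real" where
  "mean_degree m j s = measure_pmf.expectation (ba_graph m s) (\<lambda>G. real (vertex_degree G s j))"

definition D :: "nat \<Rightarrow> nat \<Rightarrow> real" where
  "D m t = 2 * real m * real t - real m * (real m + 1)"

text \<open>\<^const>\<open>D\<close> is the total degree of every graph that the process can reach.\<close>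
lemma total_degree_ba_graph:
  assumes "m > 0" "m + 1 \<le> t"
  shows "\<forall>G\<in>set_pmf (ba_graph m t).
    (\<forall>k j. k \<notin> {1..t} \<or> j \<notin> {1..t} \<longrightarrow> G k j = 0) \<and> real (total_degree G t) = D m t"
  using assms(2)
proof (induction t rule: dec_induct)
  case base
  have s: "set_pmf (ba_graph m (m + 1)) = {complete_graph (m + 1)}" by simp
  have d: "vertex_degree (complete_graph (m+1)) (m+1) j = m" if "j \<in> {1..m+1}" for j
  proof -
    have "vertex_degree (complete_graph (m+1)) (m+1) j = (\<Sum>i\<in>{1..m+1}. if i \<in> {1..m+1} - {j} then 1 else 0)"
      unfolding vertex_degree_def complete_graph_def using that by (intro sum.cong) auto
    also have "\<dots> = card ({1..m+1} - {j})"
      by (subst sum.inter_restrict[symmetric]) (auto simp: Int_absorb1)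
    also have "\<dots> = m" using that by (subst card_Diff_singleton) auto
    finally show ?thesis .
  qed
  have "total_degree (complete_graph (m+1)) (m+1) = (m+1) * m"
    unfolding total_degree_def using d by simp
  then show ?case unfolding s by (auto simp: D_def complete_graph_def algebra_simps)
next
  case (step t)
  show ?case
  proof
    fix H assume "H \<in> set_pmf (ba_graph m (Suc t))"
    with step.hyps obtain G js where G: "G \<in> set_pmf (ba_graph m t)"
      and js: "js \<in> set_pmf (replicate_pmf m (target_pmf G t))" and H: "H = attach G (Suc t) js"
      by (auto simp: set_bind_pmf split: if_splits)
    from step.IH G have z: "\<And>k j. k \<notin> {1..t} \<or> j \<notin> {1..t} \<Longrightarrow> G k j = 0"
      and tot: "real (total_degree G t) = D m t" by blast+
    have "D m t = real m * (2 * real t - real m - 1)" by (simp add: D_def algebra_simps)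
    also have "\<dots> > 0" using assms(1) step.hyps by (intro mult_pos_pos) auto
    finally have pos: "total_degree G t > 0" using tot by linarith
    have len: "length js = m" and sub: "set js \<subseteq> set_pmf (target_pmf G t)"
      using js by (auto simp: set_replicate_pmf)
    have "set js \<subseteq> {1..t}"
      using sub by (auto simp: set_pmf_eq pmf_target_pmf[OF pos] split: if_splits)
    then have out: "\<And>j. j \<notin> {1..t} \<Longrightarrow> count_list js j = 0"
      by (metis count_notin subsetD)
    have cnt: "(\<Sum>j\<in>{1..t}. count_list js j) = m"
      using sum_count_set[of js "{1..t}"] \<open>set js \<subseteq> {1..t}\<close> len by simp
    have zH: "\<forall>k j. k \<notin> {1..Suc t} \<or> j \<notin> {1..Suc t} \<longrightarrow> H k j = 0"
      unfolding H attach_def using z out by auto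
    have dg: "vertex_degree H (Suc t) j = vertex_degree G t j + count_list js j" if "j \<in> {1..t}" for j
      using that z[of j "Suc t"] out[of "Suc t"] unfolding vertex_degree_def H attach_def by simp
    have dn: "vertex_degree H (Suc t) (Suc t) = m"
      using z out[of "Suc t"] cnt unfolding vertex_degree_def H attach_def by simp
    have "total_degree H (Suc t) = total_degree G t + 2 * m"
      unfolding total_degree_def using dg dn cnt by (simp add: sum.distrib)
    then have "real (total_degree H (Suc t)) = D m (Suc t)"
      using tot by (simp add: D_def algebra_simps)
    with zH show "(\<forall>k j. k \<notin> {1..Suc t} \<or> j \<notin> {1..Suc t} \<longrightarrow> H k j = 0)
        \<and> real (total_degree H (Suc t)) = D m (Suc t)" by blast
  qed
qed

text \<open>The sizes \<open>n\<close> for which \<open>c n\<close> is an integer, the number \<open>m = c n\<close>, and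
  \<open>n \<rightarrow> \<infinity>\<close> along these sizes.\<close>
definition sizes :: "real \<Rightarrow> nat set" where
  "sizes c = {n. 0 < n \<and> c * real n \<in> \<int>}"

definition num_edges :: "real \<Rightarrow> nat \<Rightarrow> nat" where
  "num_edges c n = nat \<lfloor>c * real n\<rfloor>"

definition at_top_sizes :: "real \<Rightarrow> nat filter" where
  "at_top_sizes c = inf sequentially (principal (sizes c))"

text \<open>The filter is a genuine one: for rational \<open>c\<close> there are arbitrarily large admissible sizes.\<close>
lemma at_top_sizes_neq_bot:
  assumes "c \<in> \<rat>"
  shows "at_top_sizes c \<noteq> bot"
proof -
  from assms obtain a b :: int where ab: "b > 0" "c = of_int a / of_int b"
    by (elim Rats_cases')
  have "\<exists>n\<ge>N. n \<in> sizes c" for N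
  proof (intro exI conjI)
    have "1 \<le> nat b" using ab by linarith
    then have "Suc N * 1 \<le> Suc N * nat b" by (rule mult_le_mono2)
    then show "N \<le> Suc N * nat b" by simp
    have "c * real (Suc N * nat b) = of_int (a * int (Suc N))"
      using ab by (simp add: field_simps)
    then show "Suc N * nat b \<in> sizes c"
      using ab unfolding sizes_def by (metis Ints_of_int mem_Collect_eq nat_0_less_mult_iff zero_less_Suc zero_less_nat_eq)
  qed
  then show ?thesis
    unfolding at_top_sizes_def trivial_limit_def[symmetric]
    by (auto simp: eventually_inf_principal eventually_sequentially trivial_limit_def)
qed

end

theory Submission
  imports Defs
begin

text \<open>
  The expectation of an entry is computed exactly and then squeezed between two elementary
  expressions. Write \<open>a t = 2t - m - 1\<close>, so that \<open>D t = m a t\<close>. Given the graph at time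
  \<open>t\<close>, each of the \<open>m\<close> new edges hits vertex \<open>j\<close> with probability \<open>d\<^sub>j(t) / D t\<close>, hence the
  expected number of new edges at \<open>j\<close> is \<open>d\<^sub>j(t) / a t\<close>. This has two consequences. First, for
  \<open>k > j\<close> and \<open>k > m + 1\<close> the entry \<open>(k, j)\<close>, which is created at time \<open>k\<close> and never changes
  afterwards, has mean \<open>\<mu>\<^sub>j(k - 1) / a (k - 1)\<close>. Second, \<open>\<mu>\<^sub>j(t + 1) = \<mu>\<^sub>j(t) (1 + 1 / a t)\<close>, starting from
  \<open>\<mu>\<^sub>j(s) = m\<close> at \<open>s = max j (m + 1)\<close>.

  The resulting product of factors \<open>1 + 1 / a t\<close> is estimated through its square. As
  \<open>a (t + 1) = a t + 2\<close>, the elementary inequalities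
  \<open>(a + 2) / a \<le> (1 + 1 / a)\<^sup>2 \<le> (a + 1) / (a - 1)\<close> make both bounds telescope, and the mean degree
  lies between \<open>m sqrt (a t / a s)\<close> and \<open>m sqrt ((a t - 1) / (a s - 1))\<close>. So, with
  \<open>b = max (k - 1) (m + 1)\<close>,
  \<open>m / sqrt (a b * a s) \<le> E M\<^sub>k\<^sub>j \<le> m / sqrt ((a b - 1) * (a s - 1))\<close>.
  The maximum in \<open>b\<close> makes this true also for the edges of the initial complete graph, so that the
  boundary case \<open>y = c\<close> is covered by the same squeeze. Dividing numerators and denominators
  by \<open>n\<close> gives the limit, and \<open>a b - 1\<close>, \<open>a s - 1 \<ge> m\<close> gives the uniform bound \<open>1\<close>.
\<close>

section \<open>Expectations over the attachment process\<close>

lemma expectation_bind_pmf_finite: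
  fixes h :: "'b \<Rightarrow> real"
  assumes "finite (set_pmf p)" "\<And>x. x \<in> set_pmf p \<Longrightarrow> finite (set_pmf (f x))"
  shows "measure_pmf.expectation (bind_pmf p f) h =
    measure_pmf.expectation p (\<lambda>x. measure_pmf.expectation (f x) h)"
  using pmf_expectation_bind[of "set_pmf p" f p h] assms
  by (subst integral_measure_pmf[of "set_pmf p"]) auto

lemma finite_set_replicate_pmf:
  "finite (set_pmf p) \<Longrightarrow> finite (set_pmf (replicate_pmf n p))"
  by (simp add: set_replicate_pmf lists_eq_set finite_lists_length_eq)

lemma expectation_pmf_cong:
  assumes "\<And>x. x \<in> set_pmf p \<Longrightarrow> f x = g x"
  shows "measure_pmf.expectation p f = (measure_pmf.expectation p g :: real)"
  using assms by (intro integral_cong_AE) (auto simp: AE_measure_pmf_iff)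

text \<open>Linearity of expectation over the independent draws.\<close>
lemma expectation_count_list_replicate_pmf:
  assumes fin: "finite (set_pmf p)"
  shows "measure_pmf.expectation (replicate_pmf n p) (\<lambda>xs. real (count_list xs y)) = real n * pmf p y"
proof (induction n)
  case 0
  then show ?case by simp
next
  case (Suc n)
  have fins: "finite (set_pmf (replicate_pmf n p))"
    using fin by (rule finite_set_replicate_pmf)
  have "measure_pmf.expectation (replicate_pmf (Suc n) p) (\<lambda>xs. real (count_list xs y)) =
    measure_pmf.expectation p (\<lambda>x. measure_pmf.expectation (replicate_pmf n p)
      (\<lambda>xs. indicator {y} x + real (count_list xs y)))"
    using fin fins
    by (simp add: expectation_bind_pmf_finite indicator_def if_distrib cong: if_cong)
       (intro expectation_pmf_cong, auto simp: integrable_measure_pmf_finite)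
  also have "\<dots> = measure_pmf.expectation p (\<lambda>x. indicator {y} x + real n * pmf p y)"
    using fins Suc.IH by (simp add: integrable_measure_pmf_finite)
  also have "\<dots> = pmf p y + real n * pmf p y"
    using fin by (simp add: integrable_measure_pmf_finite measure_pmf_single)
  finally show ?case by (simp add: algebra_simps)
qed

text \<open>
  The total degree divided by \<open>m\<close>; its reciprocal is the expected relative growth of a degree
  in the step from time \<open>t\<close> to \<open>t + 1\<close>. It is the \<open>a t\<close> of
  the introductory explanation.
\<close>
definition norm_time :: "nat \<Rightarrow> nat \<Rightarrow> real" where
  "norm_time m t = 2 * real t - real m - 1"

lemma D_eq_norm_time: "D m t = real m * norm_time m t"
  by (simp add: D_def norm_time_def algebra_simps)

lemma norm_time_ge: "m + 1 \<le> t \<Longrightarrow> real m + 1 \<le> norm_time m t"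
  by (simp add: norm_time_def)

lemma norm_time_Suc: "norm_time m (Suc t) = norm_time m t + 2"
  by (simp add: norm_time_def)

lemma D_pos: "m > 0 \<Longrightarrow> m + 1 \<le> t \<Longrightarrow> D m t > 0"
  using norm_time_ge[of m t] by (simp add: D_eq_norm_time)

lemma ba_graph_reachable:
  assumes "m > 0" "m + 1 \<le> t" "G \<in> set_pmf (ba_graph m t)"
  shows "real (total_degree G t) = D m t" "total_degree G t > 0"
    and "k \<notin> {1..t} \<or> j \<notin> {1..t} \<Longrightarrow> G k j = 0"
  using total_degree_ba_graph[OF assms(1,2)] assms(3) D_pos[OF assms(1,2)] by auto

lemma set_target_pmf:
  assumes "total_degree G t > 0"
  shows "set_pmf (target_pmf G t) \<subseteq> {1..t}"
  by (auto simp: set_pmf_eq pmf_target_pmf[OF assms] split: if_splits)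

lemma finite_target_pmf: "total_degree G t > 0 \<Longrightarrow> finite (set_pmf (target_pmf G t))"
  using set_target_pmf finite_subset by blast

lemma finite_set_ba_graph:
  assumes "m > 0"
  shows "finite (set_pmf (ba_graph m t))"
proof (induction t)
  case (Suc t)
  then show ?case
    using ba_graph_reachable(2)[OF assms]
    by (auto intro!: finite_set_replicate_pmf finite_target_pmf)
qed simp

lemma expectation_ba_graph_Suc:
  fixes f :: "multigraph \<Rightarrow> real"
  assumes "m > 0" "m + 1 \<le> t"
  shows "measure_pmf.expectation (ba_graph m (Suc t)) f =
    measure_pmf.expectation (ba_graph m t) (\<lambda>G.
      measure_pmf.expectation (replicate_pmf m (target_pmf G t)) (\<lambda>js. f (attach G (Suc t) js)))"
  using assms ba_graph_reachable(2)[OF assms] finite_set_ba_graph[OF assms(1), of t]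
  by (simp add: expectation_bind_pmf_finite finite_set_replicate_pmf finite_target_pmf)

text \<open>The drawn endpoints are old vertices, so the new vertex gets no loop and exactly \<open>m\<close> edges.\<close>
lemma count_list_targets:
  assumes "total_degree G t > 0" "js \<in> set_pmf (replicate_pmf m (target_pmf G t))"
  shows "count_list js (Suc t) = 0" "(\<Sum>i\<in>{1..t}. count_list js i) = m"
proof -
  have len: "length js = m" and sub: "set js \<subseteq> {1..t}"
    using assms(2) set_target_pmf[OF assms(1)] by (auto simp: set_replicate_pmf)
  from sub show "count_list js (Suc t) = 0" by (intro count_notin) auto
  show "(\<Sum>i\<in>{1..t}. count_list js i) = m"
    using sum_count_set[OF sub] len by simp
qed

lemma expectation_new_edges:
  assumes "m > 0" "m + 1 \<le> t" "G \<in> set_pmf (ba_graph m t)" "j \<in> {1..t}"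
  shows "measure_pmf.expectation (replicate_pmf m (target_pmf G t)) (\<lambda>js. real (count_list js j)) =
    real (vertex_degree G t j) / norm_time m t"
  using ba_graph_reachable(1,2)[OF assms(1-3)] assms(1,4)
  by (simp add: expectation_count_list_replicate_pmf finite_target_pmf pmf_target_pmf D_eq_norm_time)

section \<open>Mean degrees\<close>

lemma mean_degree_Suc:
  assumes "m > 0" "m + 1 \<le> t" "j \<in> {1..t}"
  shows "mean_degree m j (Suc t) = mean_degree m j t * (1 + 1 / norm_time m t)"
proof -
  have "measure_pmf.expectation (replicate_pmf m (target_pmf G t))
      (\<lambda>js. real (vertex_degree (attach G (Suc t) js) (Suc t) j)) =
      real (vertex_degree G t j) * (1 + 1 / norm_time m t)" (is "?E = _")
    if G: "G \<in> set_pmf (ba_graph m t)" for G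
  proof -
    note reach = ba_graph_reachable[OF assms(1,2) G]
    have "vertex_degree (attach G (Suc t) js) (Suc t) j = vertex_degree G t j + count_list js j"
      if "js \<in> set_pmf (replicate_pmf m (target_pmf G t))" for js
      using assms(3) reach(3)[of j "Suc t"] count_list_targets(1)[OF reach(2) that]
      by (simp add: vertex_degree_def attach_def)
    then have "?E = measure_pmf.expectation (replicate_pmf m (target_pmf G t))
        (\<lambda>js. real (vertex_degree G t j) + real (count_list js j))"
      by (intro expectation_pmf_cong) simp
    also have "\<dots> = real (vertex_degree G t j) + real (vertex_degree G t j) / norm_time m t"
      using expectation_new_edges[OF assms(1,2) G assms(3)] reach(2)
      by (simp add: integrable_measure_pmf_finite finite_set_replicate_pmf finite_target_pmf)
    finally show ?thesis by (simp add: algebra_simps)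
  qed
  then have "mean_degree m j (Suc t) =
      measure_pmf.expectation (ba_graph m t) (\<lambda>G. real (vertex_degree G t j) * (1 + 1 / norm_time m t))"
    unfolding mean_degree_def expectation_ba_graph_Suc[OF assms(1,2)]
    by (rule expectation_pmf_cong)
  then show ?thesis by (simp add: mean_degree_def)
qed

lemma vertex_degree_complete_graph:
  assumes "j \<in> {1..s}"
  shows "vertex_degree (complete_graph s) s j = s - 1"
proof -
  have "vertex_degree (complete_graph s) s j = (\<Sum>i\<in>{1..s} - {j}. 1)"
    unfolding vertex_degree_def complete_graph_def using assms
    by (intro sum.mono_neutral_cong_right) auto
  then show ?thesis using assms by simp
qed

lemma mean_degree_initial:
  assumes "m > 0" "j \<ge> 1"
  shows "mean_degree m j (max j (m + 1)) = real m"
proof (cases "j \<le> m + 1")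
  case True
  then show ?thesis
    using assms(2) vertex_degree_complete_graph[of j "m + 1"]
    by (simp add: mean_degree_def max_def)
next
  case False
  then obtain t where t: "j = Suc t" "m + 1 \<le> t" by (cases j) auto
  have "vertex_degree (attach G (Suc t) js) (Suc t) (Suc t) = m"
    if G: "G \<in> set_pmf (ba_graph m t)" and js: "js \<in> set_pmf (replicate_pmf m (target_pmf G t))" for G js
  proof -
    note reach = ba_graph_reachable[OF assms(1) t(2) G]
    show ?thesis
      using reach(3)[of "Suc t"] count_list_targets[OF reach(2) js]
      by (simp add: vertex_degree_def attach_def)
  qed
  then have "mean_degree m j j = measure_pmf.expectation (ba_graph m t) (\<lambda>_. real m)"
    unfolding mean_degree_def t(1) expectation_ba_graph_Suc[OF assms(1) t(2)]
    by (intro expectation_pmf_cong) (simp cong: expectation_pmf_cong)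
  then show ?thesis using False by (simp add: max_def)
qed

lemma ratio_le_square_growth:
  fixes a :: real
  assumes "a > 0"
  shows "(a + 2) / a \<le> (1 + 1 / a)\<^sup>2"
  using assms by (simp add: power2_eq_square field_simps)

lemma square_growth_le_ratio:
  fixes a :: real
  assumes "a > 1"
  shows "(1 + 1 / a)\<^sup>2 \<le> (a + 1) / (a - 1)"
proof -
  have "(1 + 1 / a)\<^sup>2 = (a + 1) * (a + 1) / (a * a)"
    using assms by (simp add: power2_eq_square field_simps)
  also have "\<dots> \<le> (a + 1) / (a - 1)"
    using assms by (simp add: divide_simps) (simp add: algebra_simps)
  finally show ?thesis .
qed

text \<open>
  Each step multiplies the square by \<open>(1 + 1 / a)\<^sup>2\<close>, and both bounds for this factor telescope
  along the arithmetic progression of the \<open>norm_time m t\<close>, which has difference \<open>2\<close>.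
\<close>
lemma mean_degree_bounds:
  assumes "m > 0" "j \<ge> 1" "max j (m + 1) \<le> t"
  shows "(real m)\<^sup>2 * (norm_time m t / norm_time m (max j (m + 1))) \<le> (mean_degree m j t)\<^sup>2
    \<and> (mean_degree m j t)\<^sup>2 \<le> (real m)\<^sup>2 * ((norm_time m t - 1) / (norm_time m (max j (m + 1)) - 1))
    \<and> 0 \<le> mean_degree m j t"
  using assms(3)
proof (induction t rule: dec_induct)
  case base
  have "norm_time m (max j (m + 1)) > 1"
    using norm_time_ge[of m "max j (m + 1)"] assms(1) by simp
  then show ?case using mean_degree_initial[OF assms(1,2)] by simp
next
  case (step t)
  define s where "s = max j (m + 1)"
  define \<mu> where "\<mu> = mean_degree m j t"
  define a where "a = norm_time m t"
  define b where "b = norm_time m s"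
  have a: "a > 1" and b: "b > 1"
    using norm_time_ge[of m t] norm_time_ge[of m s] step.hyps assms(1)
    by (auto simp: a_def b_def s_def)
  have next_mean: "mean_degree m j (Suc t) = \<mu> * (1 + 1 / a)"
    unfolding \<mu>_def a_def using step.hyps assms by (intro mean_degree_Suc) auto
  have lo: "(real m)\<^sup>2 * (a / b) \<le> \<mu>\<^sup>2" and hi: "\<mu>\<^sup>2 \<le> (real m)\<^sup>2 * ((a - 1) / (b - 1))" and nn: "0 \<le> \<mu>"
    using step.IH by (auto simp: \<mu>_def a_def b_def s_def)
  have "(real m)\<^sup>2 * ((a + 2) / b) = (real m)\<^sup>2 * (a / b) * ((a + 2) / a)"
    using a b by simp
  also have "\<dots> \<le> \<mu>\<^sup>2 * (1 + 1 / a)\<^sup>2"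
    using a lo by (intro mult_mono ratio_le_square_growth) auto
  finally have lo': "(real m)\<^sup>2 * ((a + 2) / b) \<le> (\<mu> * (1 + 1 / a))\<^sup>2"
    by (simp add: power_mult_distrib)
  have "(\<mu> * (1 + 1 / a))\<^sup>2 = \<mu>\<^sup>2 * (1 + 1 / a)\<^sup>2"
    by (simp add: power_mult_distrib)
  also have "\<dots> \<le> (real m)\<^sup>2 * ((a - 1) / (b - 1)) * ((a + 1) / (a - 1))"
    using a b hi by (intro mult_mono square_growth_le_ratio) auto
  also have "\<dots> = (real m)\<^sup>2 * ((a + 2 - 1) / (b - 1))"
    using a b by simp
  finally have hi': "(\<mu> * (1 + 1 / a))\<^sup>2 \<le> (real m)\<^sup>2 * ((a + 2 - 1) / (b - 1))" .
  show ?case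
    using lo' hi' nn a
    unfolding next_mean norm_time_Suc a_def[symmetric] s_def[symmetric] b_def[symmetric]
    by simp
qed

section \<open>Mean entries\<close>

lemma mean_entry_initial:
  assumes "n \<le> m + 1"
  shows "mean_entry m n k j = real (complete_graph (m + 1) k j)"
  using assms by (cases n) (simp_all add: mean_entry_def)

lemma mean_entry_Suc_old:
  assumes "m > 0" "k \<le> t" "j \<le> t"
  shows "mean_entry m (Suc t) k j = mean_entry m t k j"
proof (cases "m + 1 \<le> t")
  case True
  show ?thesis
    unfolding mean_entry_def expectation_ba_graph_Suc[OF assms(1) True]
    using assms by (simp add: attach_def)
next
  case False
  then show ?thesis by (simp add: mean_entry_initial)
qed

lemma mean_entry_old:
  assumes "m > 0" "k \<le> n" "j \<le> k"
  shows "mean_entry m n k j = mean_entry m k k j"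
  using assms(2)
proof (induction n rule: dec_induct)
  case (step n)
  then show ?case using mean_entry_Suc_old[of m k n j] assms by simp
qed simp

lemma mean_entry_eq_mean_degree:
  assumes "m > 0" "1 \<le> j" "j < k" "k \<le> n" "m + 1 < k"
  shows "mean_entry m n k j = mean_degree m j (k - 1) / norm_time m (k - 1)"
proof -
  from assms obtain t where t: "k = Suc t" "m + 1 \<le> t" "j \<in> {1..t}" by (cases k) auto
  have "measure_pmf.expectation (replicate_pmf m (target_pmf G t))
      (\<lambda>js. real (attach G (Suc t) js (Suc t) j)) = real (vertex_degree G t j) / norm_time m t"
    if G: "G \<in> set_pmf (ba_graph m t)" for G
    using expectation_new_edges[OF assms(1) t(2) G t(3)]
      ba_graph_reachable(3)[OF assms(1) t(2) G, of "Suc t" j] t(3)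
    by (simp add: attach_def)
  then have "mean_entry m k k j = measure_pmf.expectation (ba_graph m t)
      (\<lambda>G. real (vertex_degree G t j) / norm_time m t)"
    unfolding mean_entry_def t(1) expectation_ba_graph_Suc[OF assms(1) t(2)]
    by (rule expectation_pmf_cong)
  then show ?thesis
    using mean_entry_old[of m k n j] assms t(1) by (simp add: mean_degree_def)
qed

lemma symmetric_loopless_ba_graph:
  assumes "m > 0" "G \<in> set_pmf (ba_graph m t)"
  shows "G k j = G j k \<and> G k k = 0"
  using assms(2)
proof (induction t arbitrary: G k j)
  case 0
  then show ?case by (auto simp: complete_graph_def)
next
  case (Suc t)
  show ?case
  proof (cases "Suc t \<le> m + 1")
    case True
    with Suc.prems show ?thesis by (auto simp: complete_graph_def)
  next
    case False
    then obtain G' js where G': "G' \<in> set_pmf (ba_graph m t)"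
      and js: "js \<in> set_pmf (replicate_pmf m (target_pmf G' t))" and G: "G = attach G' (Suc t) js"
      using Suc.prems by auto
    have "count_list js (Suc t) = 0"
      using count_list_targets(1)[OF _ js] ba_graph_reachable(2)[OF assms(1) _ G'] False by simp
    then show ?thesis
      using Suc.IH[OF G', of k j] Suc.IH[OF G', of k k] unfolding G attach_def by auto
  qed
qed

lemma mean_entry_commute: "m > 0 \<Longrightarrow> mean_entry m n k j = mean_entry m n j k"
  unfolding mean_entry_def using symmetric_loopless_ba_graph
  by (intro expectation_pmf_cong) metis

lemma mean_entry_diagonal:
  assumes "m > 0"
  shows "mean_entry m n k k = 0"
proof -
  have "mean_entry m n k k = measure_pmf.expectation (ba_graph m n) (\<lambda>_. 0)"
    unfolding mean_entry_def using symmetric_loopless_ba_graph[OF assms]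
    by (intro expectation_pmf_cong) simp
  then show ?thesis by simp
qed

text \<open>
  For \<open>k \<le> m + 1\<close> the entry is \<open>1\<close>, and the bounds reduce to \<open>m / (m + 1)\<close> and \<open>1\<close>. For later
  \<open>k\<close> they come from the mean degree bounds, which give
  \<open>m sqrt (a - 1) / (a sqrt (b - 1))\<close> on the upper side. Weakening the factor
  \<open>sqrt (a - 1) / a\<close> to \<open>1 / sqrt (a - 1)\<close> is what makes the bound cover \<open>k \<le> m + 1\<close> as well.
\<close>
lemma mean_entry_bounds:
  assumes "m > 0" "1 \<le> j" "j < k" "k \<le> n"
  defines "a \<equiv> norm_time m (max (k - 1) (m + 1))" and "b \<equiv> norm_time m (max j (m + 1))"
  shows "real m / sqrt (b * a) \<le> mean_entry m n k j"
    and "mean_entry m n k j \<le> real m / sqrt ((b - 1) * (a - 1))"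
proof -
  have a: "a \<ge> real m + 1" and b: "b \<ge> real m + 1"
    unfolding a_def b_def by (intro norm_time_ge; simp)+
  have "real m / sqrt (b * a) \<le> mean_entry m n k j \<and>
      mean_entry m n k j \<le> real m / sqrt ((b - 1) * (a - 1))"
  proof (cases "k \<le> m + 1")
    case True
    have "mean_entry m n k j = mean_entry m k k j"
      using assms by (intro mean_entry_old) auto
    also have "\<dots> = 1"
      using True assms by (simp add: mean_entry_initial complete_graph_def)
    finally have one: "mean_entry m n k j = 1" .
    have "a = real m + 1" "b = real m + 1"
      using True assms(3) by (simp_all add: a_def b_def norm_time_def max_def)
    then show ?thesis using one assms(1) by simp
  next
    case False
    define \<mu> where "\<mu> = mean_degree m j (k - 1)"
    have max: "max (k - 1) (m + 1) = k - 1" using False by simp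
    have entry: "mean_entry m n k j = \<mu> / a"
      using mean_entry_eq_mean_degree[OF assms(1-4)] False by (simp add: \<mu>_def a_def max)
    have "max j (m + 1) \<le> k - 1" using False assms(3) by auto
    note md = mean_degree_bounds[OF assms(1,2) this, folded \<mu>_def b_def]
    have lo: "(real m)\<^sup>2 * (a / b) \<le> \<mu>\<^sup>2" and hi: "\<mu>\<^sup>2 \<le> (real m)\<^sup>2 * ((a - 1) / (b - 1))"
      and nn: "0 \<le> \<mu>"
      using md unfolding a_def max by auto
    have pos: "a > 1" "b > 1" using a b assms(1) by auto
    have "(real m / sqrt (b * a))\<^sup>2 = (real m)\<^sup>2 * (a / b) / a\<^sup>2"
      using pos by (simp add: power_divide) (simp add: power2_eq_square)
    also have "\<dots> \<le> \<mu>\<^sup>2 / a\<^sup>2"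
      using lo by (intro divide_right_mono) auto
    finally have 1: "(real m / sqrt (b * a))\<^sup>2 \<le> (\<mu> / a)\<^sup>2"
      by (simp add: power_divide)
    have "(\<mu> / a)\<^sup>2 \<le> (real m)\<^sup>2 * ((a - 1) / (b - 1)) / a\<^sup>2"
      unfolding power_divide using hi by (rule divide_right_mono) simp
    also have "\<dots> = (real m)\<^sup>2 / (b - 1) * ((a - 1) / a\<^sup>2)"
      by simp
    also have "\<dots> \<le> (real m)\<^sup>2 / (b - 1) * (1 / (a - 1))"
    proof (rule mult_left_mono)
      have "(a - 1) * (a - 1) \<le> a * a" using pos by (intro mult_mono) auto
      then show "(a - 1) / a\<^sup>2 \<le> 1 / (a - 1)"
        using pos by (simp add: field_simps power2_eq_square)
    qed (use pos in auto)
    also have "\<dots> = (real m / sqrt ((b - 1) * (a - 1)))\<^sup>2"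
      using pos by (simp add: power_divide)
    finally have 2: "(\<mu> / a)\<^sup>2 \<le> (real m / sqrt ((b - 1) * (a - 1)))\<^sup>2" .
    show ?thesis unfolding entry
      using power2_le_imp_le[OF 1] power2_le_imp_le[OF 2] nn pos by simp
  qed
  then show "real m / sqrt (b * a) \<le> mean_entry m n k j"
    and "mean_entry m n k j \<le> real m / sqrt ((b - 1) * (a - 1))" by auto
qed

lemma mean_entry_nonneg: "0 \<le> mean_entry m n k j"
  by (simp add: mean_entry_def)

lemma mean_entry_le_1:
  assumes "m > 0" "k \<in> {1..n}" "j \<in> {1..n}"
  shows "mean_entry m n k j \<le> 1"
proof -
  have less: "mean_entry m n k j \<le> 1" if "1 \<le> j" "j < k" "k \<le> n" for k j
  proof -
    define a where "a = norm_time m (max (k - 1) (m + 1))"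
    define b where "b = norm_time m (max j (m + 1))"
    have "a \<ge> real m + 1" "b \<ge> real m + 1"
      unfolding a_def b_def by (intro norm_time_ge; simp)+
    then have "real m * real m \<le> (b - 1) * (a - 1)"
      by (intro mult_mono) auto
    then have "real m \<le> sqrt ((b - 1) * (a - 1))"
      by (intro real_le_rsqrt) (simp add: power2_eq_square)
    moreover from this have "sqrt ((b - 1) * (a - 1)) > 0"
      using assms(1) by linarith
    ultimately have "real m / sqrt ((b - 1) * (a - 1)) \<le> 1"
      by simp
    then show ?thesis
      using mean_entry_bounds(2)[OF assms(1) that] by (simp add: a_def b_def)
  qed
  consider "j < k" | "k < j" | "j = k" by linarith
  then show ?thesis
  proof cases
    case 2
    then show ?thesis using less[of k j] assms mean_entry_commute[of m n k j] by simp
  qed (use less[of j k] assms mean_entry_diagonal in auto)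
qed

section \<open>The limit along the admissible sizes\<close>

lemma num_edges_sizes:
  assumes "0 < c" "n \<in> sizes c"
  shows "real (num_edges c n) = c * real n" "num_edges c n > 0"
proof -
  have "c * real n > 0" "of_int \<lfloor>c * real n\<rfloor> = c * real n"
    using assms by (auto simp: sizes_def)
  moreover from this have "real (num_edges c n) = of_int \<lfloor>c * real n\<rfloor>"
    unfolding num_edges_def by (intro of_nat_nat) simp
  ultimately show eq: "real (num_edges c n) = c * real n" by simp
  with \<open>c * real n > 0\<close> show "num_edges c n > 0" by (metis of_nat_0_less_iff)
qed

lemma eventually_at_top_sizes: "\<forall>\<^sub>F n in at_top_sizes c. n \<in> sizes c"
  unfolding at_top_sizes_def by (simp add: eventually_inf_principal)

lemma tendsto_const_div_at_top_sizes: "((\<lambda>n. r / real n) \<longlongrightarrow> 0) (at_top_sizes c)"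
  unfolding at_top_sizes_def
  by (rule tendsto_mono[OF inf_le1 lim_const_over_n])

text \<open>
  Shifts by a constant vanish after division by \<open>n\<close>. The parameter \<open>r\<close> lets the lemma serve
  the lower bound on a mean entry, with \<open>r = 0\<close>, as well as the upper one, with \<open>r = 1\<close>.
\<close>
lemma norm_time_max_tendsto:
  assumes "0 < c" "((\<lambda>n. real (i n) / real n) \<longlongrightarrow> x) (at_top_sizes c)"
  shows "((\<lambda>n. (norm_time (num_edges c n) (max (i n) (num_edges c n + 1)) - r) / real n)
    \<longlongrightarrow> 2 * max x c - c) (at_top_sizes c)"
proof -
  have "((\<lambda>n. 2 * max (real (i n) / real n) (c + 1 / real n) - c - (1 + r) / real n)
      \<longlongrightarrow> 2 * max x (c + 0) - c - 0) (at_top_sizes c)"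
    using assms(2) by (intro tendsto_intros tendsto_max tendsto_const_div_at_top_sizes)
  moreover have "\<forall>\<^sub>F n in at_top_sizes c.
      2 * max (real (i n) / real n) (c + 1 / real n) - c - (1 + r) / real n =
      (norm_time (num_edges c n) (max (i n) (num_edges c n + 1)) - r) / real n"
    using eventually_at_top_sizes
  proof eventually_elim
    case (elim n)
    have n: "real n > 0" using elim by (simp add: sizes_def)
    have "max (real (i n) / real n) (c + 1 / real n) = max (real (i n)) (c * real n + 1) / real n"
      using n by (simp add: max_def field_simps)
    then show ?case
      using n num_edges_sizes(1)[OF assms(1) elim]
      by (simp add: norm_time_def of_nat_max field_simps)
  qed
  ultimately show ?thesis by (simp add: tendsto_cong)
qed

lemma mean_entry_bound_tendsto:
  assumes c: "0 < c" and y: "c \<le> y"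
    and k: "((\<lambda>n. real (k n) / real n) \<longlongrightarrow> y) (at_top_sizes c)"
    and j: "((\<lambda>n. real (j n) / real n) \<longlongrightarrow> x) (at_top_sizes c)"
  shows "((\<lambda>n. real (num_edges c n) /
      sqrt ((norm_time (num_edges c n) (max (j n) (num_edges c n + 1)) - r) *
            (norm_time (num_edges c n) (max (k n - 1) (num_edges c n + 1)) - r)))
    \<longlongrightarrow> c / sqrt ((2 * max x c - c) * (2 * y - c))) (at_top_sizes c)"
proof -
  define a where "a = (\<lambda>n. norm_time (num_edges c n) (max (k n - 1) (num_edges c n + 1)) - r)"
  define b where "b = (\<lambda>n. norm_time (num_edges c n) (max (j n) (num_edges c n + 1)) - r)"
  have shift: "((\<lambda>n. real (k n - 1) / real n) \<longlongrightarrow> y) (at_top_sizes c)"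
  proof (rule tendsto_sandwich)
    show "((\<lambda>n. real (k n) / real n - 1 / real n) \<longlongrightarrow> y) (at_top_sizes c)"
      using tendsto_diff[OF k tendsto_const_div_at_top_sizes[of 1 c]] by simp
    show "\<forall>\<^sub>F n in at_top_sizes c. real (k n) / real n - 1 / real n \<le> real (k n - 1) / real n"
      by (rule always_eventually)
        (auto simp: diff_divide_distrib[symmetric] intro!: divide_right_mono)
    show "\<forall>\<^sub>F n in at_top_sizes c. real (k n - 1) / real n \<le> real (k n) / real n"
      by (rule always_eventually) (auto intro!: divide_right_mono)
  qed (rule k)
  have a: "((\<lambda>n. a n / real n) \<longlongrightarrow> 2 * y - c) (at_top_sizes c)"
    using norm_time_max_tendsto[OF c shift, of r] y by (simp add: a_def max_absorb1)
  have b: "((\<lambda>n. b n / real n) \<longlongrightarrow> 2 * max x c - c) (at_top_sizes c)"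
    using norm_time_max_tendsto[OF c j, of r] by (simp add: b_def)
  have "(2 * max x c - c) * (2 * y - c) > 0"
    using c y by (intro mult_pos_pos) auto
  then have "((\<lambda>n. c / sqrt ((b n / real n) * (a n / real n)))
      \<longlongrightarrow> c / sqrt ((2 * max x c - c) * (2 * y - c))) (at_top_sizes c)"
    using a b by (intro tendsto_intros) auto
  moreover have "\<forall>\<^sub>F n in at_top_sizes c.
      c / sqrt ((b n / real n) * (a n / real n)) = real (num_edges c n) / sqrt (b n * a n)"
    using eventually_at_top_sizes
  proof eventually_elim
    case (elim n)
    have "real n > 0" using elim by (simp add: sizes_def)
    moreover from this have "sqrt ((b n / real n) * (a n / real n)) = sqrt (b n * a n) / real n"
      by (simp add: real_sqrt_divide real_sqrt_mult)
    ultimately show ?case using num_edges_sizes(1)[OF c elim] by simp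
  qed
  ultimately show ?thesis by (simp add: tendsto_cong a_def b_def)
qed

lemma mean_entry_tendsto:
  assumes c: "0 < c" and y: "c \<le> y"
    and jk: "\<forall>\<^sub>F n in at_top_sizes c. 1 \<le> j n \<and> j n < k n \<and> k n \<le> n"
    and k: "((\<lambda>n. real (k n) / real n) \<longlongrightarrow> y) (at_top_sizes c)"
    and j: "((\<lambda>n. real (j n) / real n) \<longlongrightarrow> x) (at_top_sizes c)"
  shows "((\<lambda>n. mean_entry (num_edges c n) n (k n) (j n))
    \<longlongrightarrow> c / sqrt ((2 * max x c - c) * (2 * y - c))) (at_top_sizes c)"
proof (rule tendsto_sandwich[OF _ _ mean_entry_bound_tendsto[OF c y k j, of 0]
      mean_entry_bound_tendsto[OF c y k j, of 1]])
  show "\<forall>\<^sub>F n in at_top_sizes c. real (num_edges c n) /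
      sqrt ((norm_time (num_edges c n) (max (j n) (num_edges c n + 1)) - 0) *
            (norm_time (num_edges c n) (max (k n - 1) (num_edges c n + 1)) - 0))
      \<le> mean_entry (num_edges c n) n (k n) (j n)"
    using eventually_at_top_sizes jk
    by eventually_elim (use mean_entry_bounds(1) num_edges_sizes(2)[OF c] in simp)
  show "\<forall>\<^sub>F n in at_top_sizes c. mean_entry (num_edges c n) n (k n) (j n) \<le>
      real (num_edges c n) /
      sqrt ((norm_time (num_edges c n) (max (j n) (num_edges c n + 1)) - 1) *
            (norm_time (num_edges c n) (max (k n - 1) (num_edges c n + 1)) - 1))"
    using eventually_at_top_sizes jk
    by eventually_elim (use mean_entry_bounds(2) num_edges_sizes(2)[OF c] in simp)
qed

theorem theorem3p1:
  fixes c :: real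
  assumes "c \<in> \<rat>" and "0 < c" and "c < 1 / 2"
  shows
    "(\<forall>n\<in>sizes c. \<forall>k j. 1 \<le> j \<and> j < k \<and> k \<le> n \<and> num_edges c n + 1 < k \<longrightarrow>
        mean_entry (num_edges c n) n k j =
          real (num_edges c n) * (mean_degree (num_edges c n) j (k - 1) / D (num_edges c n) (k - 1)))
     \<and>
     (\<forall>(k :: nat \<Rightarrow> nat) (j :: nat \<Rightarrow> nat) (x :: real) (y :: real).
        0 < x \<and> x \<le> 1 \<and> 0 < y \<and> y \<le> 1 \<and> c \<le> y \<and>
        (\<forall>\<^sub>F n in at_top_sizes c. 1 \<le> j n \<and> j n < k n \<and> k n \<le> n) \<and>
        ((\<lambda>n. real (k n) / real n) \<longlongrightarrow> y) (at_top_sizes c) \<and>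
        ((\<lambda>n. real (j n) / real n) \<longlongrightarrow> x) (at_top_sizes c) \<longrightarrow>
        ((\<lambda>n. mean_entry (num_edges c n) n (k n) (j n)) \<longlongrightarrow>
           c / sqrt ((2 * max x c - c) * (2 * y - c))) (at_top_sizes c))
     \<and>
     (\<exists>C. \<forall>n\<in>sizes c. \<forall>k\<in>{1..n}. \<forall>j\<in>{1..n}.
        \<bar>mean_entry (num_edges c n) n k j\<bar> \<le> C)"
proof (intro conjI)
  show "\<forall>n\<in>sizes c. \<forall>k j. 1 \<le> j \<and> j < k \<and> k \<le> n \<and> num_edges c n + 1 < k \<longrightarrow>
        mean_entry (num_edges c n) n k j =
          real (num_edges c n) * (mean_degree (num_edges c n) j (k - 1) / D (num_edges c n) (k - 1))"
  proof (intro ballI allI impI)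
    fix n k j
    assume "n \<in> sizes c" and kj: "1 \<le> j \<and> j < k \<and> k \<le> n \<and> num_edges c n + 1 < k"
    then have "num_edges c n > 0" using num_edges_sizes(2)[OF assms(2)] by simp
    then show "mean_entry (num_edges c n) n k j =
        real (num_edges c n) * (mean_degree (num_edges c n) j (k - 1) / D (num_edges c n) (k - 1))"
      using kj mean_entry_eq_mean_degree[of "num_edges c n" j k n] by (simp add: D_eq_norm_time)
  qed
  show "\<forall>(k :: nat \<Rightarrow> nat) (j :: nat \<Rightarrow> nat) (x :: real) (y :: real).
        0 < x \<and> x \<le> 1 \<and> 0 < y \<and> y \<le> 1 \<and> c \<le> y \<and>
        (\<forall>\<^sub>F n in at_top_sizes c. 1 \<le> j n \<and> j n < k n \<and> k n \<le> n) \<and>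
        ((\<lambda>n. real (k n) / real n) \<longlongrightarrow> y) (at_top_sizes c) \<and>
        ((\<lambda>n. real (j n) / real n) \<longlongrightarrow> x) (at_top_sizes c) \<longrightarrow>
        ((\<lambda>n. mean_entry (num_edges c n) n (k n) (j n)) \<longlongrightarrow>
           c / sqrt ((2 * max x c - c) * (2 * y - c))) (at_top_sizes c)"
    using mean_entry_tendsto[OF assms(2)] by blast
  show "\<exists>C. \<forall>n\<in>sizes c. \<forall>k\<in>{1..n}. \<forall>j\<in>{1..n}.
        \<bar>mean_entry (num_edges c n) n k j\<bar> \<le> C"
    using num_edges_sizes(2)[OF assms(2)]
    by (intro exI[of _ 1]) (simp add: mean_entry_nonneg mean_entry_le_1)
qed

end
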